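(* Let $R$ be a UFD and let $I$ be an ideal of $R$ such that $R/I$ has zero divisors, i.e. there exist nonzero $x,y\in R/I$ with $xy=0$. Then for every $n\ge 3$ there is a matrix $B=[b_{ij}]\in M_n(R)$ such that $$\Theta(\mathrm{Cen}(B))+[\mathcal A_{ij}]\neq\mathrm{Cen}(\widehat B),$$ where $$\mathcal A_{ij}=\left(\bigcap_{k,\ k\neq j}\mathrm{ann}(\hat b_{jk})\right)\cap\left(\bigcap_{k,\ k\neq i}\mathrm{ann}(\hat b_{ki})\right)\cap\mathrm{ann}(\hat b_{ii}-\hat b_{jj}).$$
   Context: For $r\in R$, $\hat r$ denotes its image in $R/I$; $\Theta:M_n(R)\to M_n(R/I)$ is the entrywise natural epimorphism, and $\widehat B=\Theta(B)$. $\mathrm{Cen}(B)$ is the centralizer of $B$ in $M_n(R)$ and $\mathrm{Cen}(\widehat B)$ is the centralizer of $\widehat B$ in $M_n(R/I)$. For $s\in R/I$, $\mathrm{ann}(s)=\{x\in R/I: xs=\hat 0\}$. $[\mathcal A_{ij}]$ denotes the set of all matrices in $M_n(R/I)$ whose $(i,j)$ entry lies in $\mathcal A_{ij}$ for all $i,j$. The sum of two sets of matrices is the set of all sums. *)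

theory Defs
  imports "HOL-Algebra.QuotRing" "HOL-Algebra.Ring_Divisibility" "Jordan_Normal_Form.Matrix"
begin

text \<open>
  The full matrix ring over a ring with an explicit carrier. Only the matrix type \<open>'a mat\<close> and
  its type-generic operations are reused: its arithmetic refers to type-class operations, not
  to those of \<open>R\<close>. Indices range over \<open>0, \<dots>, n - 1\<close>.
\<close>

definition matrix_ring :: "('a, 'm) ring_scheme \<Rightarrow> nat \<Rightarrow> 'a mat ring" where
  "matrix_ring R n =
    \<lparr>carrier = {A \<in> carrier_mat n n. \<forall>i<n. \<forall>j<n. A $$ (i, j) \<in> carrier R},
     monoid.mult = (\<lambda>A B. mat n n (\<lambda>(i, j). \<Oplus>\<^bsub>R\<^esub>k\<in>{..<n}. A $$ (i, k) \<otimes>\<^bsub>R\<^esub> B $$ (k, j))),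
     one = mat n n (\<lambda>(i, j). if i = j then \<one>\<^bsub>R\<^esub> else \<zero>\<^bsub>R\<^esub>),
     zero = mat n n (\<lambda>(i, j). \<zero>\<^bsub>R\<^esub>),
     add = (\<lambda>A B. mat n n (\<lambda>(i, j). A $$ (i, j) \<oplus>\<^bsub>R\<^esub> B $$ (i, j)))\<rparr>"

definition centralizer :: "('a, 'm) monoid_scheme \<Rightarrow> 'a \<Rightarrow> 'a set" where
  "centralizer S b = {x \<in> carrier S. x \<otimes>\<^bsub>S\<^esub> b = b \<otimes>\<^bsub>S\<^esub> x}"

definition annihilator :: "('a, 'm) ring_scheme \<Rightarrow> 'a \<Rightarrow> 'a set" where
  "annihilator S s = {x \<in> carrier S. x \<otimes>\<^bsub>S\<^esub> s = \<zero>\<^bsub>S\<^esub>}"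

definition reduce_mat :: "('a, 'm) ring_scheme \<Rightarrow> 'a set \<Rightarrow> 'a mat \<Rightarrow> 'a set mat" where
  "reduce_mat R I B = map_mat (\<lambda>r. I +>\<^bsub>R\<^esub> r) B"

definition matrices_in ::
  "('a, 'm) ring_scheme \<Rightarrow> nat \<Rightarrow> (nat \<Rightarrow> nat \<Rightarrow> 'a set) \<Rightarrow> 'a mat set" where
  "matrices_in S n \<A> =
    {X \<in> carrier (matrix_ring S n). \<forall>i<n. \<forall>j<n. X $$ (i, j) \<in> \<A> i j}"

definition ann_entry ::
  "('a, 'm) ring_scheme \<Rightarrow> nat \<Rightarrow> 'a mat \<Rightarrow> nat \<Rightarrow> nat \<Rightarrow> 'a set" where
  "ann_entry S n C i j =
    (\<Inter>k\<in>{..<n} - {j}. annihilator S (C $$ (j, k))) \<inter>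
    (\<Inter>k\<in>{..<n} - {i}. annihilator S (C $$ (k, i))) \<inter>
    annihilator S (C $$ (i, i) \<ominus>\<^bsub>S\<^esub> C $$ (j, j))"

end

theory Submission
  imports Defs
begin

text \<open>
  Pick \<open>0 \<noteq> z \<in> I\<close> and let \<open>B\<close> have first column \<open>1\<close> and, apart from that, only the entries \<open>-z\<close> at
  \<open>(1, 1)\<close> and \<open>z\<close> at \<open>(1, 2)\<close>. Modulo \<open>I\<close> only the first column survives, so
  \<open>X = E\<^sub>2\<^sub>2 - E\<^sub>2\<^sub>1\<close> commutes with the reduction of \<open>B\<close>. If \<open>C\<close> commutes with \<open>B\<close>, then
  subtracting the entries \<open>(0, 2)\<close> from the entries \<open>(1, 2)\<close> of \<open>C B = B C\<close> and cancelling \<open>z\<close>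
  gives \<open>C\<^sub>1\<^sub>1 - C\<^sub>0\<^sub>1 = C\<^sub>2\<^sub>2 - C\<^sub>1\<^sub>2\<close>. The units in the first column make the annihilator
  conditions trivial in columns \<open>1\<close> and \<open>2\<close>, so \<open>C\<close> would have to agree with \<open>X\<close> there modulo \<open>I\<close>,
  and the identity would become \<open>0 = 1\<close> in \<open>R/I\<close>.
\<close>

lemma carrier_matrix_ringI:
  assumes "A \<in> carrier_mat n n" "\<And>i j. i < n \<Longrightarrow> j < n \<Longrightarrow> A $$ (i, j) \<in> carrier S"
  shows "A \<in> carrier (matrix_ring S n)"
  using assms by (simp add: matrix_ring_def)

lemma carrier_matrix_ringD:
  assumes "A \<in> carrier (matrix_ring S n)"
  shows "A \<in> carrier_mat n n" "\<And>i j. i < n \<Longrightarrow> j < n \<Longrightarrow> A $$ (i, j) \<in> carrier S"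
  using assms by (simp_all add: matrix_ring_def)

lemma matrix_ring_add_entry:
  assumes "i < n" "j < n"
  shows "(A \<oplus>\<^bsub>matrix_ring S n\<^esub> B) $$ (i, j) = A $$ (i, j) \<oplus>\<^bsub>S\<^esub> B $$ (i, j)"
  using assms by (simp add: matrix_ring_def)

lemma matrix_ring_mult_carrier_mat: "A \<otimes>\<^bsub>matrix_ring S n\<^esub> B \<in> carrier_mat n n"
  by (simp add: matrix_ring_def)

text \<open>All matrices multiplied below have at most three relevant summands per entry: the
  witness and the commuting matrix vanish in every column from 3 on, and column 2 of the witness
  vanishes in every row from 3 on. This makes the computations uniform in \<open>n\<close>.\<close>

lemma (in ring) matrix_ring_mult_entry3:
  assumes A: "A \<in> carrier (matrix_ring R n)" and B: "B \<in> carrier (matrix_ring R n)"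
    and ij: "i < n" "j < n" and n: "3 \<le> n"
    and zero: "\<And>k. 3 \<le> k \<Longrightarrow> k < n \<Longrightarrow> A $$ (i, k) = \<zero> \<or> B $$ (k, j) = \<zero>"
  shows "(A \<otimes>\<^bsub>matrix_ring R n\<^esub> B) $$ (i, j) =
    A $$ (i, 0) \<otimes> B $$ (0, j) \<oplus> (A $$ (i, 1) \<otimes> B $$ (1, j) \<oplus> A $$ (i, 2) \<otimes> B $$ (2, j))"
proof -
  let ?f = "\<lambda>k. A $$ (i, k) \<otimes> B $$ (k, j)"
  have closed: "A $$ (i, k) \<in> carrier R" "B $$ (k, j) \<in> carrier R" if "k < n" for k
    using that carrier_matrix_ringD[OF A] carrier_matrix_ringD[OF B] ij by auto
  have "(A \<otimes>\<^bsub>matrix_ring R n\<^esub> B) $$ (i, j) = (\<Oplus>k\<in>{..<n}. ?f k)"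
    using ij by (simp add: matrix_ring_def)
  also have "\<dots> = (\<Oplus>k\<in>{0, 1, 2}. ?f k)"
  proof (rule add.finprod_mono_neutral_cong_right)
    show "?f k = \<zero>" if "k \<in> {..<n} - {0, 1, 2}" for k
      using zero[of k] closed[of k] that by auto
  qed (use n closed in auto)
  also have "\<dots> = ?f 0 \<oplus> (?f 1 \<oplus> ?f 2)"
    using n closed by (simp add: Pi_def)
  finally show ?thesis .
qed

lemma reduce_mat_entry:
  assumes "A \<in> carrier_mat n n" "i < n" "j < n"
  shows "reduce_mat R I A $$ (i, j) = I +>\<^bsub>R\<^esub> A $$ (i, j)"
  using assms by (simp add: reduce_mat_def)

lemma (in ring) annihilator_one: "annihilator R \<one> = {\<zero>}"
  by (auto simp: annihilator_def)

text \<open>Rows 1 and 0 differ by \<open>z\<close> times \<open>(0, -1, 1, 0, ...)\<close>, which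
  is what forces the relation on centralizing matrices. Ring and \<open>z\<close> are parameters so
  that the reduction modulo \<open>I\<close> is again of this form.\<close>

definition witness_mat :: "('a, 'm) ring_scheme \<Rightarrow> nat \<Rightarrow> 'a \<Rightarrow> 'a mat" where
  "witness_mat R n z = mat n n (\<lambda>(i, j).
     if j = 0 then \<one>\<^bsub>R\<^esub> else if i = 1 \<and> j = 1 then \<ominus>\<^bsub>R\<^esub> z
     else if i = 1 \<and> j = 2 then z else \<zero>\<^bsub>R\<^esub>)"

lemma (in ring) witness_mat_carrier:
  assumes "z \<in> carrier R"
  shows "witness_mat R n z \<in> carrier (matrix_ring R n)"
  using assms by (intro carrier_matrix_ringI) (auto simp: witness_mat_def)

lemma (in domain) centralizer_witness_mat:
  assumes z: "z \<in> carrier R" "z \<noteq> \<zero>" and n: "3 \<le> n"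
    and C: "C \<in> centralizer (matrix_ring R n) (witness_mat R n z)"
  shows "C $$ (1, 1) \<ominus> C $$ (0, 1) = C $$ (2, 2) \<ominus> C $$ (1, 2)"
proof -
  let ?B = "witness_mat R n z"
  note B = witness_mat_carrier[OF z(1), of n]
  have Cc: "C \<in> carrier (matrix_ring R n)"
    and comm: "C \<otimes>\<^bsub>matrix_ring R n\<^esub> ?B = ?B \<otimes>\<^bsub>matrix_ring R n\<^esub> C"
    using C by (auto simp: centralizer_def)
  have c: "C $$ (i, j) \<in> carrier R" if "i < 3" "j < 3" for i j
    using carrier_matrix_ringD(2)[OF Cc] that n by simp
  \<comment> \<open>Column 2 of \<open>?B\<close> has its only possibly nonzero entry,
    \<open>z\<close>, in row 1.\<close>
  have left: "(C \<otimes>\<^bsub>matrix_ring R n\<^esub> ?B) $$ (i, 2) = C $$ (i, 1) \<otimes> z" if "i < 3" for i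
    using that n z c by (subst matrix_ring_mult_entry3[OF Cc B]) (auto simp: witness_mat_def)
  have "(?B \<otimes>\<^bsub>matrix_ring R n\<^esub> C) $$ (0, 2) = C $$ (0, 2)"
    using n z c by (subst matrix_ring_mult_entry3[OF B Cc]) (auto simp: witness_mat_def)
  then have row0: "C $$ (0, 1) \<otimes> z = C $$ (0, 2)"
    using left[of 0] comm by simp
  have "(?B \<otimes>\<^bsub>matrix_ring R n\<^esub> C) $$ (1, 2)
      = C $$ (0, 2) \<oplus> (\<ominus> z \<otimes> C $$ (1, 2) \<oplus> z \<otimes> C $$ (2, 2))"
    using n z c by (subst matrix_ring_mult_entry3[OF B Cc]) (auto simp: witness_mat_def)
  then have row1: "C $$ (1, 1) \<otimes> z = C $$ (0, 2) \<oplus> (\<ominus> z \<otimes> C $$ (1, 2) \<oplus> z \<otimes> C $$ (2, 2))"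
    using left[of 1] comm by simp
  have entries: "C $$ (0, 1) \<in> carrier R" "C $$ (1, 1) \<in> carrier R" "C $$ (0, 2) \<in> carrier R"
    "C $$ (1, 2) \<in> carrier R" "C $$ (2, 2) \<in> carrier R"
    using c by auto
  \<comment> \<open>Both \<open>row0\<close> and \<open>row1\<close> contain
    \<open>C $$ (0, 2)\<close>, coming from the leading 1 of rows 0 and 1 of \<open>?B\<close>; the
    difference removes it and leaves a multiple of \<open>z\<close> on each side.\<close>
  have "z \<otimes> (C $$ (1, 1) \<ominus> C $$ (0, 1)) = C $$ (1, 1) \<otimes> z \<ominus> C $$ (0, 1) \<otimes> z"
    using z(1) entries by algebra
  also have "\<dots> = z \<otimes> (C $$ (2, 2) \<ominus> C $$ (1, 2))"
    unfolding row0 row1 using z(1) entries(3-5) by algebra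
  finally show ?thesis
    using z entries by (simp add: m_lcancel)
qed

lemma (in ideal) reduce_witness_mat:
  assumes "z \<in> I"
  shows "reduce_mat R I (witness_mat R n z) = witness_mat (R Quot I) n \<zero>\<^bsub>R Quot I\<^esub>"
proof -
  interpret Q: ring "R Quot I" by (rule quotient_is_ring)
  have "I +> z = I" "I +> \<ominus> z = I" "I +> \<zero> = I"
    using assms by (auto intro!: a_rcos_const)
  then show ?thesis
    using Q.minus_zero
    by (intro eq_matI) (auto simp: reduce_mat_def witness_mat_def FactRing_def)
qed

definition commuting_mat :: "('a, 'm) ring_scheme \<Rightarrow> nat \<Rightarrow> 'a mat" where
  "commuting_mat S n = mat n n (\<lambda>(i, j).
     if i = 2 \<and> j = 2 then \<one>\<^bsub>S\<^esub> else if i = 2 \<and> j = 1 then \<ominus>\<^bsub>S\<^esub> \<one>\<^bsub>S\<^esub> else \<zero>\<^bsub>S\<^esub>)"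

text \<open>Both products are zero. Each row of the commuting matrix sums to zero, so it kills the
  column of ones; its row 0 is zero, and column 0 of the witness can only meet that row.\<close>

lemma (in ring) commuting_mat_centralizes:
  assumes n: "3 \<le> n"
  shows "commuting_mat R n \<in> centralizer (matrix_ring R n) (witness_mat R n \<zero>)"
proof -
  let ?X = "commuting_mat R n" and ?B = "witness_mat R n \<zero>"
  have X: "?X \<in> carrier (matrix_ring R n)"
    by (intro carrier_matrix_ringI) (auto simp: commuting_mat_def)
  note B = witness_mat_carrier[OF zero_closed, of n]
  have "(?X \<otimes>\<^bsub>matrix_ring R n\<^esub> ?B) $$ (i, j) = (?B \<otimes>\<^bsub>matrix_ring R n\<^esub> ?X) $$ (i, j)"
    if "i < n" "j < n" for i j
  proof -
    have "(?X \<otimes>\<^bsub>matrix_ring R n\<^esub> ?B) $$ (i, j) = \<zero>"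
      using that n
      by (subst matrix_ring_mult_entry3[OF X B])
        (auto simp: witness_mat_def commuting_mat_def l_neg)
    moreover have "(?B \<otimes>\<^bsub>matrix_ring R n\<^esub> ?X) $$ (i, j) = \<zero>"
      using that n
      by (subst matrix_ring_mult_entry3[OF B X]) (auto simp: witness_mat_def commuting_mat_def)
    ultimately show ?thesis by simp
  qed
  then have "?X \<otimes>\<^bsub>matrix_ring R n\<^esub> ?B = ?B \<otimes>\<^bsub>matrix_ring R n\<^esub> ?X"
    using matrix_ring_mult_carrier_mat[of R n] by (intro eq_matI) (metis carrier_matD)+
  with X show ?thesis by (simp add: centralizer_def)
qed

text \<open>As \<open>j\<close> is not 0, the index \<open>k = 0\<close> occurs in the first
  intersection, where the entry at \<open>(j, 0)\<close> is a unit and has zero annihilator.\<close>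

lemma (in ring) ann_entry_witness_mat:
  assumes "3 \<le> n" "j = 1 \<or> j = 2"
  shows "ann_entry R n (witness_mat R n z) i j \<subseteq> {\<zero>}"
proof -
  have "0 \<in> {..<n} - {j}" "witness_mat R n z $$ (j, 0) = \<one>"
    using assms by (auto simp: witness_mat_def)
  then have "ann_entry R n (witness_mat R n z) i j \<subseteq> annihilator R \<one>"
    unfolding ann_entry_def by (metis INT_lower inf.coboundedI1)
  then show ?thesis
    by (simp add: annihilator_one)
qed

theorem (in domain) centralizer_lift_fails:
  assumes "ideal I R" and z: "z \<in> I" "z \<noteq> \<zero>" and proper: "\<one> \<notin> I" and n: "3 \<le> n"
  shows "\<exists>B\<in>carrier (matrix_ring R n).
           reduce_mat R I ` centralizer (matrix_ring R n) B
             <+>\<^bsub>matrix_ring (R Quot I) n\<^esub>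
             matrices_in (R Quot I) n (ann_entry (R Quot I) n (reduce_mat R I B))
           \<noteq> centralizer (matrix_ring (R Quot I) n) (reduce_mat R I B)"
proof -
  interpret ideal I R by fact
  let ?Q = "R Quot I"
  interpret Q: ring ?Q by (rule quotient_is_ring)
  have zc: "z \<in> carrier R"
    using z(1) by simp
  have one: "\<one>\<^bsub>?Q\<^esub> \<noteq> \<zero>\<^bsub>?Q\<^esub>"
  proof
    assume "\<one>\<^bsub>?Q\<^esub> = \<zero>\<^bsub>?Q\<^esub>"
    then have "I +> \<one> = I"
      by (simp add: FactRing_def)
    then show False
      using proper a_rcos_self[OF one_closed] by simp
  qed
  interpret h: ring_hom_ring R ?Q "(+>) I" by (rule rcos_ring_hom_ring)
  let ?B = "witness_mat R n z"
  have red: "reduce_mat R I ?B = witness_mat ?Q n \<zero>\<^bsub>?Q\<^esub>"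
    by (rule reduce_witness_mat[OF z(1)])
  let ?X = "commuting_mat ?Q n"
  have "?X \<notin> reduce_mat R I ` centralizer (matrix_ring R n) ?B <+>\<^bsub>matrix_ring ?Q n\<^esub>
      matrices_in ?Q n (ann_entry ?Q n (reduce_mat R I ?B))"
  proof
    assume "?X \<in> reduce_mat R I ` centralizer (matrix_ring R n) ?B <+>\<^bsub>matrix_ring ?Q n\<^esub>
      matrices_in ?Q n (ann_entry ?Q n (reduce_mat R I ?B))"
    then obtain C A where C: "C \<in> centralizer (matrix_ring R n) ?B"
      and A: "A \<in> matrices_in ?Q n (ann_entry ?Q n (witness_mat ?Q n \<zero>\<^bsub>?Q\<^esub>))"
      and X: "?X = reduce_mat R I C \<oplus>\<^bsub>matrix_ring ?Q n\<^esub> A"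
      unfolding red set_add_defs by auto
    have Cc: "C \<in> carrier (matrix_ring R n)"
      using C by (simp add: centralizer_def)
    have c: "C $$ (i, j) \<in> carrier R" if "i < 3" "j < 3" for i j
      using carrier_matrix_ringD(2)[OF Cc] that n by simp
    have entry: "I +> C $$ (i, j) = ?X $$ (i, j)" if "i < 3" "j = 1 \<or> j = 2" for i j
    proof -
      have ij: "i < n" "j < n" "j < 3" using that n by auto
      have "A $$ (i, j) \<in> ann_entry ?Q n (witness_mat ?Q n \<zero>\<^bsub>?Q\<^esub>) i j"
        using A ij by (simp add: matrices_in_def)
      then have "A $$ (i, j) = \<zero>\<^bsub>?Q\<^esub>"
        using Q.ann_entry_witness_mat[OF n that(2)] by blast
      then show ?thesis
        unfolding X using ij c[of i j] that carrier_matrix_ringD(1)[OF Cc]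
        by (simp add: matrix_ring_add_entry reduce_mat_entry)
    qed
    have "I +> (C $$ (1, 1) \<ominus> C $$ (0, 1)) = I +> (C $$ (2, 2) \<ominus> C $$ (1, 2))"
      using centralizer_witness_mat[OF zc z(2) n C] by simp
    \<comment> \<open>The quotient map is a ring homomorphism, and all four entries lie in columns 1
      and 2, where \<open>entry\<close> applies. Of them only \<open>?X $$ (2, 2)\<close> is
      nonzero.\<close>
    then have "?X $$ (1, 1) \<ominus>\<^bsub>?Q\<^esub> ?X $$ (0, 1) = ?X $$ (2, 2) \<ominus>\<^bsub>?Q\<^esub> ?X $$ (1, 2)"
      using c entry by (simp add: a_minus_def)
    then show False
      using one n by (simp add: commuting_mat_def a_minus_def)
  qed
  moreover have "?X \<in> centralizer (matrix_ring ?Q n) (reduce_mat R I ?B)"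
    unfolding red by (rule Q.commuting_mat_centralizes[OF n])
  ultimately show ?thesis
    using witness_mat_carrier[OF zc] by metis
qed

theorem mainTheorem5:
  fixes R :: "('a, 'm) ring_scheme" and I :: "'a set" and n :: nat
  assumes "factorial_domain R"
    and "ideal I R"
    and "\<exists>x\<in>carrier (R Quot I). \<exists>y\<in>carrier (R Quot I).
           x \<noteq> \<zero>\<^bsub>R Quot I\<^esub> \<and> y \<noteq> \<zero>\<^bsub>R Quot I\<^esub> \<and> x \<otimes>\<^bsub>R Quot I\<^esub> y = \<zero>\<^bsub>R Quot I\<^esub>"
    and "n \<ge> 3"
  shows "\<exists>B\<in>carrier (matrix_ring R n).
           reduce_mat R I ` centralizer (matrix_ring R n) B
             <+>\<^bsub>matrix_ring (R Quot I) n\<^esub>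
             matrices_in (R Quot I) n (ann_entry (R Quot I) n (reduce_mat R I B))
           \<noteq> centralizer (matrix_ring (R Quot I) n) (reduce_mat R I B)"
proof -
  interpret factorial_domain R by fact
  interpret ideal I R by fact
  obtain X Y where X: "X \<in> carrier (R Quot I)" "X \<noteq> \<zero>\<^bsub>R Quot I\<^esub>"
    and Y: "Y \<in> carrier (R Quot I)" "Y \<noteq> \<zero>\<^bsub>R Quot I\<^esub>" and XY: "X \<otimes>\<^bsub>R Quot I\<^esub> Y = \<zero>\<^bsub>R Quot I\<^esub>"
    using assms(3) by blast
  \<comment> \<open>The product of these representatives serves as \<open>z\<close>: it lies in
    \<open>I\<close> because \<open>X\<close> and \<open>Y\<close> multiply to zero, and it is
    nonzero because neither factor is. That \<open>x\<close> lies outside \<open>I\<close> also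
    shows \<open>I\<close> to be proper.\<close>
  obtain x y where x: "x \<in> carrier R" "X = I +>\<^bsub>R\<^esub> x" and y: "y \<in> carrier R" "Y = I +>\<^bsub>R\<^esub> y"
    using X(1) Y(1) by (auto simp: FactRing_def A_RCOSETS_def')
  have notin: "x \<notin> I" "y \<notin> I"
    using X(2) Y(2) x y a_rcos_const by (auto simp: FactRing_def)
  then have "x \<noteq> \<zero>\<^bsub>R\<^esub>" "y \<noteq> \<zero>\<^bsub>R\<^esub>"
    by auto
  then have nonzero: "x \<otimes>\<^bsub>R\<^esub> y \<noteq> \<zero>\<^bsub>R\<^esub>"
    using x y integral by blast
  have "I +>\<^bsub>R\<^esub> (x \<otimes>\<^bsub>R\<^esub> y) = I"
    using XY x y by (simp add: FactRing_def rcoset_mult_add)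
  then have zI: "x \<otimes>\<^bsub>R\<^esub> y \<in> I"
    using x y a_rcos_self by force
  have "\<one>\<^bsub>R\<^esub> \<notin> I"
    using notin x one_imp_carrier by blast
  then show ?thesis
    using centralizer_lift_fails[OF assms(2) zI nonzero] assms(4) by blast
qed

end
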